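(* For each $\ell\in\mathbf{Z}^{(\mathcal{B})}$ and each integer $n\geqslant 0$, we have $\zeta(\ell)_{n,n}=\sigma(\delta(\ell))_n$. In particular $\zeta(\ell)=\sigma(\delta(\ell))$.
   Context: A composition is a finite sequence $\mathbf{a}=(a_1,\ldots,a_r)$ of positive integers ($r\geqslant 0$), of depth $r$ and weight $|\mathbf{a}|=\sum a_i$; it is admissible if $r=0$ or $a_1\geqslant 2$. $\mathcal{A}$ (resp. $\mathcal{A}_k$) is the set of admissible compositions (resp. of weight $k$). Binary word: $\mathbf{w}(\mathbf{a})=0^{a_1-1}1\cdots0^{a_r-1}1$. The dual of a word $\varepsilon_1\cdots\varepsilon_k$ is $\overline{\varepsilon_k}\cdots\overline{\varepsilon_1}$ ($\overline0=1,\overline1=0$); for admissible $\mathbf{a}$, $\overline{\mathbf{a}}$ is the admissible composition with word dual to $\mathbf{w}(\mathbf{a})$. $\mathcal{B}$ is $\mathcal{A}$ modulo $\mathbf{a}\sim\overline{\mathbf{a}}$, with classes $[\mathbf{a}]$; $\mathbf{Z}^{(X)}$ is the free $\mathbf{Z}$-module on $X$. For a composition, $(a_1,\ldots,a_r)^{\rm init}=(a_1,\ldots,a_{r-1})$ ($\varnothing^{\rm init}=\varnothing$); for admissible $\mathbf{a}$, $\mathbf{a}^{\rm fin}$ is the dual of $(\overline{\mathbf{a}})^{\rm init}$ and $\mathbf{a}^{\rm mid}=(\mathbf{a}^{\rm fin})^{\rm init}$; extended $\mathbf{Z}$-linearly. $\delta:\mathbf{Z}^{(\mathcal{B})}\to\mathbf{Z}^{(\mathcal{A})}$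 is the unique $\mathbf{Z}$-linear map with $\delta(\mathbf{Z}^{\mathcal{B}_k})\subset\mathbf{Z}^{\mathcal{A}_k}$ for all $k$, $\delta([\varnothing])=\varnothing$, and $\delta([\mathbf{a}])^{\rm init}=\delta([\mathbf{a}^{\rm init}])+\delta([\mathbf{a}^{\rm mid}])+\delta([\mathbf{a}^{\rm fin}])$ for all non-empty admissible $\mathbf{a}$. Double tails: for non-empty admissible $\mathbf{a}$ and $m,n\geqslant0$, $\zeta(\mathbf{a})_{m,n}=\sum_{n_1>\cdots>n_r>n}\binom{n_1+m}{m}^{-1}n_1^{-a_1}\cdots n_r^{-a_r}$, and $\zeta(\varnothing)_{m,n}=\binom{m+n}{m}^{-1}$; $\zeta(\mathbf{a})=\zeta(\mathbf{a})_{0,0}$. Since $\zeta(\mathbf{a})_{n,n}=\zeta(\overline{\mathbf{a}})_{n,n}$, $[\mathbf{a}]\mapsto\zeta(\mathbf{a})_{n,n}$ extends to a $\mathbf{Z}$-linear map $\ell\mapsto\zeta(\ell)_{n,n}$ on $\mathbf{Z}^{(\mathcal{B})}$, and $\zeta(\ell)=\zeta(\ell)_{0,0}$. For any composition $\mathbf{a}$ and $n\geqslant0$, $\sigma(\mathbf{a})_n=\sum_{n_1>\cdots>n_r>n}\binom{2n_1}{n_1}^{-1}n_1^{-a_1}\cdots n_r^{-a_r}$ if $r\geqslant1$, $\sigma(\varnothing)_n=\binom{2n}{n}^{-1}$, $\sigma(\mathbf{a})=\sigma(\mathbf{a})_0$; extended $\mathbf{Z}$-linearly to $\mathbf{Z}^{(\mathcal{A})}$.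 *)

theory Defs
  imports "HOL-Analysis.Analysis" "HOL-Library.Poly_Mapping"
begin

definition composition :: "nat list \<Rightarrow> bool" where
  "composition a \<longleftrightarrow> (\<forall>k\<in>set a. k \<ge> 1)"

definition admissible :: "nat list \<Rightarrow> bool" where
  "admissible a \<longleftrightarrow> composition a \<and> (a = [] \<or> hd a \<ge> 2)"

text \<open>Binary words are lists of booleans: \<^term>\<open>False\<close> is the letter 0, \<^term>\<open>True\<close> the letter 1.\<close>

definition word :: "nat list \<Rightarrow> bool list" where
  "word a = concat (map (\<lambda>k. replicate (k - 1) False @ [True]) a)"

definition dual_word :: "bool list \<Rightarrow> bool list" where
  "dual_word w = rev (map Not w)"

lemma word_simps [simp]:
  "word [] = []"
  "word (k # a) = replicate (k - 1) False @ True # word a"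
  "word (a @ b) = word a @ word b"
  by (simp_all add: word_def)

lemma dual_word_dual_word [simp]: "dual_word (dual_word w) = w"
  by (simp add: dual_word_def rev_map comp_def)

lemma composition_simps [simp]:
  "composition []"
  "composition (k # a) \<longleftrightarrow> k \<ge> 1 \<and> composition a"
  "composition (a @ b) \<longleftrightarrow> composition a \<and> composition b"
  by (auto simp: composition_def)

lemma length_word: "composition a \<Longrightarrow> length (word a) = sum_list a"
  by (induction a) auto

lemma takeWhile_replicate_False:
  "takeWhile Not (replicate p False @ True # u) = replicate p False"
  by (induction p) auto

lemma word_inj: "composition a \<Longrightarrow> composition b \<Longrightarrow> word a = word b \<Longrightarrow> a = b"
proof (induction a arbitrary: b)
  case Nil
  then show ?case by (cases b) auto
next
  case (Cons k a)
  then obtain j c where b: "b = j # c" by (cases b) auto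
  have "replicate (k - 1) False = replicate (j - 1) False"
    using arg_cong[OF Cons.prems(3), of "takeWhile Not"]
    by (simp add: b takeWhile_replicate_False)
  then have "k - 1 = j - 1" by (metis length_replicate)
  moreover have "k \<ge> 1" "j \<ge> 1" using Cons.prems b by simp_all
  ultimately have "k = j" by linarith
  moreover have "a = c" using Cons.prems \<open>k = j\<close> b by (intro Cons.IH) simp_all
  ultimately show ?case using b by simp
qed

lemma word_surj: "w = [] \<or> last w \<Longrightarrow> \<exists>a. composition a \<and> word a = w"
proof (induction w)
  case Nil
  then show ?case by (intro exI[of _ "[]"]) simp
next
  case (Cons x w)
  then obtain a where a: "composition a" "word a = w" by (auto split: if_splits)
  show ?case
  proof (cases x)
    case True
    with a show ?thesis by (intro exI[of _ "1 # a"]) simp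
  next
    case False
    with Cons.prems have "w \<noteq> []" by auto
    with a obtain k b where "a = k # b" by (cases a) auto
    with a False show ?thesis
      by (intro exI[of _ "Suc k # b"]) (cases k; auto)
  qed
qed

lemma admissible_iff_word:
  assumes "composition a"
  shows "admissible a \<longleftrightarrow> word a = [] \<or> \<not> hd (word a)"
proof (cases a)
  case (Cons k b)
  with assms show ?thesis
    by (cases "k - 1") (auto simp: admissible_def)
qed (simp add: admissible_def)

lemma last_word: "a \<noteq> [] \<Longrightarrow> last (word a)"
  by (induction a rule: rev_induct) auto

lemma dual_exists: "admissible a \<Longrightarrow> \<exists>b. admissible b \<and> word b = dual_word (word a)"
proof (cases "word a = []")
  case True
  then show ?thesis by (intro exI[of _ "[]"]) (simp add: admissible_def dual_word_def)
next
  case False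
  assume a: "admissible a"
  then have c: "composition a" by (simp add: admissible_def)
  have "last (dual_word (word a))"
    using False a admissible_iff_word[OF c] by (simp add: dual_word_def last_rev hd_map)
  then obtain b where b: "composition b" "word b = dual_word (word a)"
    using word_surj by blast
  have "\<not> hd (word b)"
    using False last_word[of a] by (cases "a = []") (simp_all add: b(2) dual_word_def hd_rev last_map)
  then show ?thesis using b admissible_iff_word by blast
qed

typedef adm = "{a :: nat list. admissible a}"
  morphisms parts Adm
  by (rule exI[of _ "[]"]) (simp add: admissible_def)

setup_lifting type_definition_adm

lift_definition adm_empty :: adm is "[]" by (simp add: admissible_def)

lift_definition weight :: "adm \<Rightarrow> nat" is sum_list .

lift_definition adm_init :: "adm \<Rightarrow> adm" is butlast
proof -
  fix a :: "nat list"
  assume a: "admissible a"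
  then have "composition (butlast a)"
    by (auto simp: admissible_def composition_def dest: in_set_butlastD)
  moreover have "butlast a = [] \<or> hd (butlast a) = hd a" by (cases a) auto
  ultimately show "admissible (butlast a)"
    using a by (cases "a = []") (auto simp: admissible_def)
qed

definition adm_dual :: "adm \<Rightarrow> adm" where
  "adm_dual a = (THE b. word (parts b) = dual_word (word (parts a)))"

definition adm_fin :: "adm \<Rightarrow> adm" where
  "adm_fin a = adm_dual (adm_init (adm_dual a))"

definition adm_mid :: "adm \<Rightarrow> adm" where
  "adm_mid a = adm_init (adm_fin a)"

lemma composition_parts: "composition (parts a)"
  using parts[of a] by (simp add: admissible_def)

lemma word_parts_inject: "word (parts a) = word (parts b) \<longleftrightarrow> a = b"
  using word_inj composition_parts parts_inject by blast

lemma word_adm_dual: "word (parts (adm_dual a)) = dual_word (word (parts a))"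
proof -
  obtain b where "admissible b" "word b = dual_word (word (parts a))"
    using dual_exists[of "parts a"] parts[of a] by auto
  then have "word (parts (Adm b)) = dual_word (word (parts a))"
    by (simp add: Adm_inverse)
  then show ?thesis
    unfolding adm_dual_def by (rule theI) (metis \<open>word (parts (Adm b)) = _\<close> word_parts_inject)
qed

lemma adm_dual_dual [simp]: "adm_dual (adm_dual a) = a"
  using word_adm_dual word_parts_inject by (metis dual_word_dual_word)

definition dual_equiv :: "adm \<Rightarrow> adm \<Rightarrow> bool" where
  "dual_equiv a b \<longleftrightarrow> b = a \<or> b = adm_dual a"

lemma equivp_dual_equiv: "equivp dual_equiv"
  by (rule equivpI) (auto simp: dual_equiv_def reflp_def symp_def transp_def)

quotient_type adm_class = adm / dual_equiv
  morphisms rep_class cls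
  by (rule equivp_dual_equiv)

definition adm_of_weight :: "nat \<Rightarrow> adm set" where
  "adm_of_weight k = {a. weight a = k}"

definition class_of_weight :: "nat \<Rightarrow> adm_class set" where
  "class_of_weight k = cls ` adm_of_weight k"

text \<open>The free \<open>\<int>\<close>-module on \<open>X\<close> is the type of finitely supported functions from \<open>X\<close> to
  \<^typ>\<open>int\<close>, with basis elements \<^term>\<open>frag_of x\<close> and scalar multiplication \<^term>\<open>frag_cmul\<close>.\<close>

definition init_lin :: "(adm \<Rightarrow>\<^sub>0 int) \<Rightarrow> (adm \<Rightarrow>\<^sub>0 int)" where
  "init_lin = frag_extend (\<lambda>a. frag_of (adm_init a))"

definition is_delta :: "((adm_class \<Rightarrow>\<^sub>0 int) \<Rightarrow> (adm \<Rightarrow>\<^sub>0 int)) \<Rightarrow> bool" where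
  "is_delta d \<longleftrightarrow>
     module_hom frag_cmul frag_cmul d \<and>
     (\<forall>k l. Poly_Mapping.keys l \<subseteq> class_of_weight k \<longrightarrow> Poly_Mapping.keys (d l) \<subseteq> adm_of_weight k) \<and>
     d (frag_of (cls adm_empty)) = frag_of adm_empty \<and>
     (\<forall>a. a \<noteq> adm_empty \<longrightarrow>
        init_lin (d (frag_of (cls a))) =
          d (frag_of (cls (adm_init a))) + d (frag_of (cls (adm_mid a))) + d (frag_of (cls (adm_fin a))))"

definition delta :: "(adm_class \<Rightarrow>\<^sub>0 int) \<Rightarrow> (adm \<Rightarrow>\<^sub>0 int)" where
  "delta = (THE d. is_delta d)"

lemma weight_word: "weight a = length (word (parts a))"
  by (simp add: weight.rep_eq length_word composition_parts)

lemma weight_dual [simp]: "weight (adm_dual a) = weight a"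
  by (simp add: weight_word word_adm_dual dual_word_def)

lemma parts_eq_Nil: "parts a = [] \<longleftrightarrow> a = adm_empty"
  using parts_inject[of a adm_empty] by (simp add: adm_empty.rep_eq)

lemma weight_ge_2: "a \<noteq> adm_empty \<Longrightarrow> weight a \<ge> 2"
  using parts[of a] parts_eq_Nil[of a]
  by (auto simp: weight.rep_eq admissible_def neq_Nil_conv)

lemma weight_empty [simp]: "weight adm_empty = 0"
  by transfer simp

lemma weight_eq_0: "weight a = 0 \<longleftrightarrow> a = adm_empty"
  using weight_ge_2[of a] by force

lemma dual_eq_empty [simp]: "adm_dual a = adm_empty \<longleftrightarrow> a = adm_empty"
  by (metis weight_dual weight_eq_0)

lemma weight_init_less: "a \<noteq> adm_empty \<Longrightarrow> weight (adm_init a) < weight a"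
  using composition_parts[of a] parts_eq_Nil[of a]
  by (cases "parts a" rule: rev_cases) (auto simp: weight.rep_eq adm_init.rep_eq)

lemma adm_init_empty [simp]: "adm_init adm_empty = adm_empty"
  by transfer simp

lemma weight_init_le: "weight (adm_init a) \<le> weight a"
  using weight_init_less[of a] by (cases "a = adm_empty") auto

lemma weight_fin_less: "a \<noteq> adm_empty \<Longrightarrow> weight (adm_fin a) < weight a"
  using weight_init_less[of "adm_dual a"] by (simp add: adm_fin_def)

lemma weight_mid_less: "a \<noteq> adm_empty \<Longrightarrow> weight (adm_mid a) < weight a"
  unfolding adm_mid_def using weight_fin_less[of a] weight_init_le[of "adm_fin a"] by simp

lemma dropWhile_replicate_False: "dropWhile Not (replicate p False @ u) = dropWhile Not u"
  by (induction p) auto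

lemma word_butlast: "word (butlast a) = rev (dropWhile Not (tl (rev (word a))))"
proof (cases a rule: rev_cases)
  case (snoc b k)
  have "dropWhile Not (rev (word b)) = rev (word b)"
    by (cases b rule: rev_cases) auto
  with snoc show ?thesis by (simp add: dropWhile_replicate_False)
qed simp

fun fin_list :: "nat list \<Rightarrow> nat list" where
  "fin_list [] = []"
| "fin_list (k # a) = (if k > 2 then (k - 1) # a else dropWhile (\<lambda>j. j = 1) a)"

lemma dropWhile_id_word: "composition a \<Longrightarrow> word (dropWhile (\<lambda>j. j = 1) a) = dropWhile id (word a)"
proof (induction a)
  case (Cons k a)
  then show ?case by (cases "k - 1") auto
qed simp

lemma word_fin_list:
  assumes "admissible a"
  shows "word (fin_list a) = dropWhile id (tl (word a))"
proof (cases a)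
  case (Cons k b)
  with assms have "k \<ge> 2" "composition b" by (auto simp: admissible_def)
  then obtain j where "k = Suc (Suc j)" by (metis add_2_eq_Suc le_Suc_ex)
  with Cons \<open>composition b\<close> show ?thesis
    using dropWhile_id_word[OF \<open>composition b\<close>] by (cases j) auto
qed simp

lemma map_Not_dropWhile: "map Not (dropWhile Not (map Not w)) = dropWhile id w"
  by (induction w) (auto simp: comp_def)

lemma word_adm_fin: "word (parts (adm_fin a)) = dropWhile id (tl (word (parts a)))"
  unfolding adm_fin_def word_adm_dual adm_init.rep_eq word_butlast
  by (simp add: dual_word_def rev_map map_tl[symmetric] map_Not_dropWhile)

lemma composition_fin_list: "composition a \<Longrightarrow> composition (fin_list a)"
  by (cases a) (auto simp: composition_def dest: set_dropWhileD)

lemma parts_adm_fin: "parts (adm_fin a) = fin_list (parts a)"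
  using parts[of a]
  by (intro word_inj composition_parts composition_fin_list)
     (simp add: word_adm_fin word_fin_list)

lemma butlast_dropWhile: "butlast (dropWhile P xs) = dropWhile P (butlast xs)"
  by (induction xs) auto

lemma butlast_fin_list: "butlast (fin_list a) = fin_list (butlast a)"
  by (cases a) (auto simp: butlast_dropWhile)

lemma init_fin: "adm_init (adm_fin a) = adm_fin (adm_init a)"
  by (subst parts_inject[symmetric]) (simp add: parts_adm_fin adm_init.rep_eq butlast_fin_list)

lemma init_dual: "adm_init (adm_dual a) = adm_dual (adm_fin a)"
  by (simp add: adm_fin_def)

lemma fin_dual: "adm_fin (adm_dual a) = adm_dual (adm_init a)"
  by (simp add: adm_fin_def)

lemma mid_dual: "adm_mid (adm_dual a) = adm_dual (adm_mid a)"
  by (simp add: adm_mid_def fin_dual init_dual init_fin)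

definition adm_snoc :: "nat \<Rightarrow> adm \<Rightarrow> adm" where
  "adm_snoc k b = Adm (parts b @ [k - weight b])"

lemma parts_adm_snoc:
  assumes "k \<ge> 2" "weight b < k"
  shows "parts (adm_snoc k b) = parts b @ [k - weight b]"
proof -
  have "admissible (parts b @ [k - weight b])"
    using parts[of b] assms by (cases "parts b = []") (auto simp: admissible_def weight.rep_eq)
  then show ?thesis by (simp add: adm_snoc_def Adm_inverse)
qed

lemma init_snoc: "k \<ge> 2 \<Longrightarrow> weight b < k \<Longrightarrow> adm_init (adm_snoc k b) = b"
  by (subst parts_inject[symmetric]) (simp add: adm_init.rep_eq parts_adm_snoc)

lemma weight_snoc: "k \<ge> 2 \<Longrightarrow> weight b < k \<Longrightarrow> weight (adm_snoc k b) = k"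
  by (simp add: weight.rep_eq parts_adm_snoc)

lemma snoc_init:
  assumes "a \<noteq> adm_empty"
  shows "adm_snoc (weight a) (adm_init a) = a"
proof -
  obtain b k where "parts a = b @ [k]"
    using assms parts_eq_Nil by (metis rev_exhaust)
  then show ?thesis
    using weight_init_less[OF assms] weight_ge_2[OF assms]
    by (subst parts_inject[symmetric]) (simp add: parts_adm_snoc weight.rep_eq adm_init.rep_eq)
qed

lemma snoc_lin_init_lin:
  assumes "k > 0" "Poly_Mapping.keys x \<subseteq> adm_of_weight k"
  shows "frag_extend (\<lambda>b. frag_of (adm_snoc k b)) (init_lin x) = x"
proof -
  have "frag_extend (\<lambda>b. frag_of (adm_snoc k b)) (init_lin x)
        = frag_extend (\<lambda>a. frag_of (adm_snoc k (adm_init a))) x"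
    using frag_extend_compose[of "\<lambda>b. frag_of (adm_snoc k b)" adm_init x]
    by (simp add: init_lin_def comp_def)
  also have "\<dots> = frag_extend frag_of x"
  proof (rule frag_extend_eq)
    fix a assume "a \<in> Poly_Mapping.keys x"
    then have "weight a = k" using assms by (auto simp: adm_of_weight_def)
    moreover from this have "a \<noteq> adm_empty" using assms(1) by auto
    ultimately show "frag_of (adm_snoc k (adm_init a)) = frag_of a"
      using snoc_init by metis
  qed
  finally show ?thesis by (simp add: frag_expansion[symmetric])
qed

lemma init_lin_snoc_lin:
  assumes "k \<ge> 2" "\<And>b. b \<in> Poly_Mapping.keys x \<Longrightarrow> weight b < k"
  shows "init_lin (frag_extend (\<lambda>b. frag_of (adm_snoc k b)) x) = x"
proof -
  have "init_lin (frag_extend (\<lambda>b. frag_of (adm_snoc k b)) x)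
        = frag_extend (\<lambda>b. frag_of (adm_init (adm_snoc k b))) x"
    using frag_extend_compose[of "\<lambda>b. frag_of (adm_init b)" "adm_snoc k" x]
    by (simp add: init_lin_def comp_def)
  also have "\<dots> = frag_extend frag_of x"
    using assms init_snoc by (intro frag_extend_eq) simp
  finally show ?thesis by (simp add: frag_expansion[symmetric])
qed

function delta_rec :: "adm \<Rightarrow> (adm \<Rightarrow>\<^sub>0 int)" where
  "delta_rec a = (if a = adm_empty then frag_of adm_empty else
     frag_extend (\<lambda>b. frag_of (adm_snoc (weight a) b))
       (delta_rec (adm_init a) + delta_rec (adm_mid a) + delta_rec (adm_fin a)))"
  by auto
termination
  by (relation "Wellfounded.measure weight")
     (simp_all only: wf_measure in_measure weight_init_less weight_mid_less weight_fin_less not_False_eq_True)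

declare delta_rec.simps [simp del]

lemma keys_add3:
  "Poly_Mapping.keys (x + y + z) \<subseteq> Poly_Mapping.keys x \<union> Poly_Mapping.keys y \<union> Poly_Mapping.keys z"
  for x y z :: "'a \<Rightarrow>\<^sub>0 int"
  using Poly_Mapping.keys_add[of "x + y" z] Poly_Mapping.keys_add[of x y] by blast

lemma weight_less_if_keys:
  assumes "a \<noteq> adm_empty"
    and "\<And>c. weight c < weight a \<Longrightarrow> Poly_Mapping.keys (f c) \<subseteq> adm_of_weight (weight c)"
    and "b \<in> Poly_Mapping.keys (f (adm_init a) + f (adm_mid a) + f (adm_fin a) :: adm \<Rightarrow>\<^sub>0 int)"
  shows "weight b < weight a"
proof -
  have "\<exists>c. weight c < weight a \<and> b \<in> Poly_Mapping.keys (f c)"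
    using subsetD[OF keys_add3 assms(3)] weight_init_less[OF assms(1)]
      weight_mid_less[OF assms(1)] weight_fin_less[OF assms(1)] by blast
  then obtain c where c: "weight c < weight a" "b \<in> Poly_Mapping.keys (f c)" by blast
  then have "weight b = weight c" using assms(2)[of c] by (auto simp: adm_of_weight_def)
  with c show ?thesis by simp
qed

lemma keys_delta_rec: "Poly_Mapping.keys (delta_rec a) \<subseteq> adm_of_weight (weight a)"
proof (induction a rule: measure_induct_rule[of weight])
  case (less a)
  show ?case
  proof (cases "a = adm_empty")
    case False
    let ?x = "delta_rec (adm_init a) + delta_rec (adm_mid a) + delta_rec (adm_fin a)"
    have x: "weight b < weight a" if "b \<in> Poly_Mapping.keys ?x" for b
      using False less that by (rule weight_less_if_keys)
    have "weight c = weight a" if "c \<in> Poly_Mapping.keys (delta_rec a)" for c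
    proof -
      have "c \<in> Poly_Mapping.keys (frag_extend (\<lambda>b. frag_of (adm_snoc (weight a) b)) ?x)"
        using that False delta_rec.simps[of a] by simp
      then obtain b where "b \<in> Poly_Mapping.keys ?x" "c = adm_snoc (weight a) b"
        using subsetD[OF keys_frag_extend] by fastforce
      then show ?thesis using x weight_snoc weight_ge_2[OF False] by simp
    qed
    then show ?thesis by (auto simp: adm_of_weight_def)
  qed (simp add: delta_rec.simps[of adm_empty] adm_of_weight_def)
qed

lemma init_lin_delta_rec:
  assumes "a \<noteq> adm_empty"
  shows "init_lin (delta_rec a) = delta_rec (adm_init a) + delta_rec (adm_mid a) + delta_rec (adm_fin a)"
proof -
  have "weight b < weight a"
    if "b \<in> Poly_Mapping.keys (delta_rec (adm_init a) + delta_rec (adm_mid a) + delta_rec (adm_fin a))" for b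
    using assms keys_delta_rec that by (rule weight_less_if_keys)
  then show ?thesis
    using assms weight_ge_2 by (simp add: delta_rec.simps[of a] init_lin_snoc_lin)
qed

lemma delta_rec_dual: "delta_rec (adm_dual a) = delta_rec a"
proof (induction a rule: measure_induct_rule[of weight])
  case (less a)
  show ?case
  proof (cases "a = adm_empty")
    case True
    then have "adm_dual a = a" by simp
    then show ?thesis by simp
  next
    case False
    then show ?thesis
      using less[OF weight_init_less[OF False]] less[OF weight_mid_less[OF False]]
        less[OF weight_fin_less[OF False]]
      by (simp add: delta_rec.simps[of a] delta_rec.simps[of "adm_dual a"]
          init_dual mid_dual fin_dual add_ac)
  qed
qed

lemma module_frag: "module frag_cmul"
  by unfold_locales (simp_all add: frag_cmul_distrib frag_cmul_distrib2)

lemma delta_rec_rep_cls: "delta_rec (rep_class (cls a)) = delta_rec a"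
proof -
  have "dual_equiv (rep_class (cls a)) a"
    by (metis Quotient3_adm_class rep_abs_rsp_left equivp_dual_equiv equivp_reflp)
  then show ?thesis by (metis dual_equiv_def delta_rec_dual)
qed

lemma is_delta_delta_rec: "is_delta (frag_extend (\<lambda>b. delta_rec (rep_class b)))"
  unfolding is_delta_def
proof (intro conjI allI impI)
  show "module_hom frag_cmul frag_cmul (frag_extend (\<lambda>b. delta_rec (rep_class b)))"
    by (intro module_hom.intro module_hom_axioms.intro module_frag)
       (simp_all add: frag_extend_add frag_extend_cmul)
next
  fix k and l :: "adm_class \<Rightarrow>\<^sub>0 int"
  assume l: "Poly_Mapping.keys l \<subseteq> class_of_weight k"
  have "Poly_Mapping.keys (delta_rec (rep_class b)) \<subseteq> adm_of_weight k"
    if b: "b \<in> Poly_Mapping.keys l" for b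
  proof -
    obtain a where "b = cls a" "weight a = k"
      using subsetD[OF l b] by (auto simp: class_of_weight_def adm_of_weight_def)
    then show ?thesis using keys_delta_rec[of a] by (simp add: delta_rec_rep_cls)
  qed
  then show "Poly_Mapping.keys (frag_extend (\<lambda>b. delta_rec (rep_class b)) l) \<subseteq> adm_of_weight k"
    by (intro order_trans[OF keys_frag_extend]) blast
qed (simp_all add: delta_rec_rep_cls init_lin_delta_rec delta_rec.simps[of adm_empty])

lemma is_delta_unique:
  assumes d: "is_delta d" and e: "is_delta e"
  shows "d = e"
proof -
  interpret d: module_hom frag_cmul frag_cmul d using d by (simp add: is_delta_def)
  interpret e: module_hom frag_cmul frag_cmul e using e by (simp add: is_delta_def)
  have basis: "d (frag_of (cls a)) = e (frag_of (cls a))" for a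
  proof (induction a rule: measure_induct_rule[of weight])
    case (less a)
    show ?case
    proof (cases "a = adm_empty")
      case True
      then show ?thesis using d e by (simp add: is_delta_def)
    next
      case False
      have "Poly_Mapping.keys (frag_of (cls a)) \<subseteq> class_of_weight (weight a)"
        by (auto simp: class_of_weight_def adm_of_weight_def)
      then have "Poly_Mapping.keys (d (frag_of (cls a))) \<subseteq> adm_of_weight (weight a)"
        "Poly_Mapping.keys (e (frag_of (cls a))) \<subseteq> adm_of_weight (weight a)"
        using d e unfolding is_delta_def by blast+
      moreover have "init_lin (d (frag_of (cls a))) = init_lin (e (frag_of (cls a)))"
        using d e False less weight_init_less[OF False] weight_mid_less[OF False]
          weight_fin_less[OF False]
        by (simp add: is_delta_def)
      moreover have "weight a > 0" using weight_ge_2[OF False] by simp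
      ultimately show ?thesis by (metis snoc_lin_init_lin)
    qed
  qed
  have "d l = e l" for l
  proof (rule frag_induction[of l UNIV "\<lambda>l. d l = e l"])
    fix x :: adm_class
    obtain a where "x = cls a" by (metis Quotient3_adm_class Quotient3_abs_rep)
    then show "d (frag_of x) = e (frag_of x)" using basis by simp
  qed (simp_all add: d.diff e.diff)
  then show ?thesis by blast
qed

lemma ex1_is_delta: "\<exists>!d. is_delta d"
  using is_delta_delta_rec is_delta_unique by blast

lemma is_delta_delta: "is_delta delta"
  unfolding delta_def using ex1_is_delta by (rule theI')

definition chains :: "nat \<Rightarrow> nat \<Rightarrow> nat list set" where
  "chains r n = {ns. length ns = r \<and> sorted_wrt (>) ns \<and> (\<forall>k\<in>set ns. k > n)}"

definition zeta_tail :: "nat list \<Rightarrow> nat \<Rightarrow> nat \<Rightarrow> real" where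
  "zeta_tail a m n =
     (if a = [] then inverse (real ((m + n) choose m))
      else \<Sum>\<^sub>\<infinity>ns\<in>chains (length a) n.
             inverse (real ((hd ns + m) choose m)) * (\<Prod>i<length a. inverse (real (ns ! i) ^ (a ! i))))"

definition sigma_tail :: "nat list \<Rightarrow> nat \<Rightarrow> real" where
  "sigma_tail a n =
     (if a = [] then inverse (real ((2 * n) choose n))
      else \<Sum>\<^sub>\<infinity>ns\<in>chains (length a) n.
             inverse (real ((2 * hd ns) choose (hd ns))) * (\<Prod>i<length a. inverse (real (ns ! i) ^ (a ! i))))"

text \<open>The common value of \<^term>\<open>zeta_tail (parts a) n n\<close> over all representatives of a class;
  it exists because the diagonal double tails are invariant under duality.\<close>

definition zeta_class :: "adm_class \<Rightarrow> nat \<Rightarrow> real" where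
  "zeta_class b n = (THE z. \<forall>a. cls a = b \<longrightarrow> zeta_tail (parts a) n n = z)"

definition int_lin_ext :: "('a \<Rightarrow> real) \<Rightarrow> ('a \<Rightarrow>\<^sub>0 int) \<Rightarrow> real" where
  "int_lin_ext f x = (\<Sum>a\<in>Poly_Mapping.keys x. of_int (Poly_Mapping.lookup x a) * f a)"

definition zeta_diag_lin :: "(adm_class \<Rightarrow>\<^sub>0 int) \<Rightarrow> nat \<Rightarrow> real" where
  "zeta_diag_lin l n = int_lin_ext (\<lambda>b. zeta_class b n) l"

definition zeta_lin :: "(adm_class \<Rightarrow>\<^sub>0 int) \<Rightarrow> real" where
  "zeta_lin l = zeta_diag_lin l 0"

definition sigma_tail_lin :: "(adm \<Rightarrow>\<^sub>0 int) \<Rightarrow> nat \<Rightarrow> real" where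
  "sigma_tail_lin x n = int_lin_ext (\<lambda>a. sigma_tail (parts a) n) x"

definition sigma_lin :: "(adm \<Rightarrow>\<^sub>0 int) \<Rightarrow> real" where
  "sigma_lin x = sigma_tail_lin x 0"

end

theory Submission
  imports Defs
begin

text \<open>
  Lowering the second index of a double tail by one splits off the terms with smallest summation
  index \<open>n\<close>; lowering the first index by one is the dual operation, which after telescoping over
  the leading parts equal to 1 produces the composition \<open>a\<close> with its final piece removed. Together:
  \[ \zeta(a)_{n-1,n-1} - \zeta(a)_{n,n} = \sum_x n^{-(|a|-|x|)} \zeta(x)_{n,n}, \]
  where \<open>x\<close> ranges over init, mid and fin of \<open>a\<close>. By the definition of \<open>\<delta>\<close> the tails
  \<open>\<sigma>(\<delta>[a])\<^sub>n\<close> satisfy the same recurrence. Both sides tend to 0 for non-empty \<open>a\<close>, so they agree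
  by induction on the weight. The argument treats each admissible composition separately, so the
  invariance of the diagonal tails under duality is a consequence of that of \<open>\<delta>\<close>.
\<close>

section \<open>Reciprocal binomial coefficients and their telescoping sums\<close>

text \<open>The factor attached to the largest index \<open>N\<close> in a double tail with first
  index \<open>m\<close>. With \<open>N\<close> as the last argument, \<open>inv_binom m\<close> is
  a weight function on indices; the diagonal \<open>inv_binom N N\<close> is the weight in
  \<open>sigma_tail\<close>.\<close>

definition inv_binom :: "nat \<Rightarrow> nat \<Rightarrow> real" where
  "inv_binom m N = inverse (real ((N + m) choose m))"

lemma inv_binom_commute: "inv_binom m N = inv_binom N m"
  using binomial_symmetric[of m "N + m"] by (simp add: inv_binom_def add.commute)

lemma inv_binom_nonneg: "inv_binom m N \<ge> 0"
  by (simp add: inv_binom_def)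

lemma inv_binom_0 [simp]: "inv_binom 0 N = 1"
  by (simp add: inv_binom_def)

text \<open>Follows from the absorption identity (N+m+1) C(N+m,m) = (m+1) C(N+m+1,m+1). The factor
  \<open>N\<close> on the right later lowers the leading exponent of a tail by one.\<close>

lemma inv_binom_diff_left:
  "inv_binom m N - inv_binom (Suc m) N = inverse (real (Suc m)) * (real N * inv_binom (Suc m) N)"
proof -
  define p q where "p = real ((N + m) choose m)" and "q = real ((N + Suc m) choose Suc m)"
  define c where "c = real (Suc m)"
  have "Suc (N + m) * ((N + m) choose m) = ((N + Suc m) choose Suc m) * Suc m"
    using Suc_times_binomial_eq[of "N + m" m] by simp
  then have "real (Suc (N + m) * ((N + m) choose m)) = real (((N + Suc m) choose Suc m) * Suc m)"
    by (rule arg_cong)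
  then have *: "(real N + c) * p = q * c"
    by (simp add: p_def q_def c_def algebra_simps)
  have "p > 0" "q > 0" "c > 0"
    by (simp_all add: p_def q_def c_def zero_less_binomial del: binomial_Suc_Suc add_Suc_right)
  with * have "inverse p - inverse q = inverse c * (real N * inverse q)"
    by (simp add: divide_simps) (simp add: algebra_simps)
  then show ?thesis
    by (simp only: inv_binom_def p_def q_def c_def)
qed

lemma inv_binom_diff_right:
  "inv_binom m N - inv_binom m (Suc N) = real m * (inv_binom m (Suc N) * inverse (real (Suc N)))"
  using inv_binom_diff_left[of N m]
  by (simp only: inv_binom_commute[of m N] inv_binom_commute[of m "Suc N"] mult_ac)

lemma inv_binom_Suc_le: "inv_binom (Suc m) N \<le> inv_binom m N"
  proof -
  have "inverse (real (Suc m)) * (real N * inv_binom (Suc m) N) \<ge> 0"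
    by (simp add: inv_binom_nonneg)
  with inv_binom_diff_left[of m N] show ?thesis by linarith
qed

lemma inv_binom_antimono: "m \<le> m' \<Longrightarrow> inv_binom m' N \<le> inv_binom m N"
  by (induction rule: dec_induct) (auto intro: order_trans inv_binom_Suc_le)

lemma inv_binom_1: "inv_binom (Suc 0) N = inverse (real N + 1)"
  by (simp add: inv_binom_def add.commute)

lemma inv_binom_le_1: "inv_binom m N \<le> 1"
  using inv_binom_antimono[of 0 m N] by simp

lemma inv_binom_le_inverse: "m \<ge> 1 \<Longrightarrow> inv_binom m N \<le> inverse (real N + 1)"
  using inv_binom_antimono[of "Suc 0" m N] by (simp add: inv_binom_1)

lemma inv_binom_tendsto_0:
  assumes "m \<ge> 1"
  shows "inv_binom m \<longlonglongrightarrow> 0"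
proof (rule tendsto_sandwich[of "\<lambda>_. 0" _ _ "\<lambda>N. inverse (real N + 1)"])
  show "(\<lambda>N. inverse (real N + 1)) \<longlonglongrightarrow> 0"
    using LIMSEQ_inverse_real_of_nat by (simp add: add.commute)
qed (use assms in \<open>auto simp: inv_binom_nonneg inv_binom_le_inverse\<close>)

text \<open>By \<open>inv_binom_diff_right\<close>, each summand is 1/m times a difference of
  consecutive values of \<open>inv_binom m\<close>, which tend to 0. The sum reproduces the same
  weight up to a constant, so a leading part 1 can be summed out.\<close>

lemma has_sum_inv_binom_telescope:
  assumes "m \<ge> 1"
  shows "((\<lambda>N. inv_binom m N * inverse (real N)) has_sum inverse (real m) * inv_binom m x) {x<..}"
proof -
  have "(\<lambda>i. inv_binom m (x + i)) \<longlonglongrightarrow> 0"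
    using LIMSEQ_ignore_initial_segment[OF inv_binom_tendsto_0[OF assms], of x]
    by (simp add: add.commute)
  from telescope_sums'[OF this]
  have "(\<lambda>i. inv_binom m (x + i) - inv_binom m (Suc (x + i))) sums inv_binom m x" by simp
  from sums_mult[OF this, of "inverse (real m)"]
  have "(\<lambda>i. inv_binom m (Suc (x + i)) * inverse (real (Suc (x + i)))) sums
          (inverse (real m) * inv_binom m x)"
    using assms unfolding inv_binom_diff_right by (simp add: field_simps)
  then have "((\<lambda>i. inv_binom m (Suc (x + i)) * inverse (real (Suc (x + i)))) has_sum
          (inverse (real m) * inv_binom m x)) UNIV"
    by (rule sums_nonneg_imp_has_sum) (simp add: inv_binom_nonneg)
  also have "?this \<longleftrightarrow> ?thesis"
    by (rule has_sum_reindex_bij_witness[of _ "\<lambda>N. N - Suc x" "\<lambda>i. Suc (x + i)"]) auto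
  finally show ?thesis .
qed

section \<open>Sums over decreasing chains and summation over the largest index\<close>

definition chain_monomial :: "nat list \<Rightarrow> nat list \<Rightarrow> real" where
  "chain_monomial a ns = (\<Prod>i<length a. inverse (real (ns ! i) ^ (a ! i)))"

text \<open>Reading the head of \<^term>\<open>ns @ [n]\<close> makes the empty composition contribute \<^term>\<open>h n\<close>,
  which is the convention for both kinds of tails.\<close>

definition chain_term :: "(nat \<Rightarrow> real) \<Rightarrow> nat list \<Rightarrow> nat \<Rightarrow> nat list \<Rightarrow> real" where
  "chain_term h a n ns = h (hd (ns @ [n])) * chain_monomial a ns"

definition chain_sum :: "(nat \<Rightarrow> real) \<Rightarrow> nat list \<Rightarrow> nat \<Rightarrow> real" where
  "chain_sum h a n = (\<Sum>\<^sub>\<infinity>ns\<in>chains (length a) n. chain_term h a n ns)"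

lemma chains_0 [simp]: "chains 0 n = {[]}"
  by (auto simp: chains_def)

lemma chain_monomial_Nil [simp]: "chain_monomial [] ns = 1"
  by (simp add: chain_monomial_def)

lemma chain_monomial_Cons [simp]:
  "chain_monomial (k # a) (N # ns) = inverse (real N ^ k) * chain_monomial a ns"
  by (simp add: chain_monomial_def prod.lessThan_Suc_shift del: prod.lessThan_Suc)

lemma chain_monomial_snoc:
  "length ns = length a \<Longrightarrow>
     chain_monomial (a @ [k]) (ns @ [N]) = chain_monomial a ns * inverse (real N ^ k)"
  by (simp add: chain_monomial_def nth_append)

lemma chain_monomial_nonneg: "chain_monomial a ns \<ge> 0"
  by (simp add: chain_monomial_def prod_nonneg)

lemma chain_sum_Nil [simp]: "chain_sum h [] n = h n"
  by (simp add: chain_sum_def chain_term_def)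

lemma chain_term_nonneg: "(\<And>N. h N \<ge> 0) \<Longrightarrow> chain_term h a n ns \<ge> 0"
  by (simp add: chain_term_def chain_monomial_nonneg)

lemma Cons_in_chains:
  "N # ns \<in> chains (Suc r) n \<longleftrightarrow> ns \<in> chains r n \<and> hd (ns @ [n]) < N"
  by (cases ns) (auto simp: chains_def)

text \<open>Fibres the chains over what remains without the largest index. For an empty remainder
  \<open>hd (ns @ [n])\<close> is \<open>n\<close>, so the lower bound on \<open>N\<close> is right
  in that case too.\<close>

lemma bij_betw_chains_Cons:
  "bij_betw (\<lambda>(ns, N). N # ns) (SIGMA ns:chains r n. {hd (ns @ [n])<..}) (chains (Suc r) n)"
proof (rule bij_betwI')
  fix ns assume ns: "ns \<in> chains (Suc r) n"
  then obtain N ms where "ns = N # ms" by (cases ns) (auto simp: chains_def)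
  with ns show "\<exists>x\<in>SIGMA ns:chains r n. {hd (ns @ [n])<..}. ns = (\<lambda>(ns, N). N # ns) x"
    by (intro bexI[of _ "(ms, N)"]) (auto simp: Cons_in_chains)
qed (auto simp: Cons_in_chains)

lemma chain_term_Cons:
  "chain_term h (k # a) n (N # ns) = h N * inverse (real N ^ k) * chain_monomial a ns"
  by (simp add: chain_term_def)

lemma has_sum_chain_term_inner:
  assumes "((\<lambda>N. h N * inverse (real N ^ k)) has_sum h' (hd (ns @ [n]))) {hd (ns @ [n])<..}"
  shows "((\<lambda>N. chain_term h (k # a) n (N # ns)) has_sum chain_term h' a n ns) {hd (ns @ [n])<..}"
  using has_sum_cmult_left[OF assms, of "chain_monomial a ns"]
  unfolding chain_term_Cons by (simp add: chain_term_def)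

text \<open>Tonelli for nonnegative terms: summing over the largest index first leaves a chain term
  of \<open>a\<close> whose weight is the inner sum \<open>h'\<close>.\<close>

lemma chain_term_Cons_summable:
  assumes inner: "\<And>x. ((\<lambda>N. h N * inverse (real N ^ k)) has_sum h' x) {x<..}"
    and outer: "chain_term h' a n summable_on chains (length a) n"
    and nonneg: "\<And>N. h N \<ge> 0"
  shows "chain_term h (k # a) n summable_on chains (Suc (length a)) n"
proof -
  have "(\<lambda>x. chain_term h (k # a) n (case x of (ns, N) \<Rightarrow> N # ns)) summable_on
          (SIGMA ns:chains (length a) n. {hd (ns @ [n])<..})"
    by (rule summable_on_SigmaI[where g = "chain_term h' a n"])
       (use outer in \<open>auto intro!: has_sum_chain_term_inner inner chain_term_nonneg nonneg\<close>)
  then show ?thesis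
    by (subst (asm) summable_on_reindex_bij_betw[OF bij_betw_chains_Cons])
qed

text \<open>Fubini along the same fibration: a leading part is traded for a change of weight from
  \<open>h\<close> to \<open>h'\<close>.\<close>

lemma chain_sum_Cons:
  assumes inner: "\<And>x. ((\<lambda>N. h N * inverse (real N ^ k)) has_sum h' x) {x<..}"
    and summable: "chain_term h (k # a) n summable_on chains (Suc (length a)) n"
  shows "chain_sum h (k # a) n = chain_sum h' a n"
proof -
  have "(chain_term h (k # a) n has_sum chain_sum h (k # a) n) (chains (Suc (length a)) n)"
    using summable by (simp add: chain_sum_def)
  then have "((\<lambda>x. chain_term h (k # a) n (case x of (ns, N) \<Rightarrow> N # ns)) has_sum
      chain_sum h (k # a) n) (SIGMA ns:chains (length a) n. {hd (ns @ [n])<..})"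
    by (subst has_sum_reindex_bij_betw[OF bij_betw_chains_Cons])
  then have "(chain_term h' a n has_sum chain_sum h (k # a) n) (chains (length a) n)"
    by (rule has_sum_SigmaD) (auto intro!: has_sum_chain_term_inner inner)
  then show ?thesis by (simp add: chain_sum_def infsumI)
qed

section \<open>Summability of chain terms\<close>

lemma chains_SucE:
  assumes "ns \<in> chains (Suc r) n"
  obtains N ms where "ns = N # ms" "N > n" "ms \<in> chains r n"
  using assms by (cases ns) (auto simp: chains_def)

text \<open>The two terms differ only in the factor of the largest index; the remaining monomial is
  common and nonnegative. Indices in a chain exceed \<open>n\<close>, so the bound is only applied
  for N \<ge> 1.\<close>

lemma chain_term_Cons_comparison:
  assumes "chain_term g (j # a) n summable_on chains (Suc (length a)) n"
    and le: "\<And>N. N \<ge> 1 \<Longrightarrow> h N * inverse (real N ^ k) \<le> C * (g N * inverse (real N ^ j))"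
    and nonneg: "\<And>N. h N \<ge> 0"
  shows "chain_term h (k # a) n summable_on chains (Suc (length a)) n"
proof (rule summable_on_comparison_test)
  show "(\<lambda>ns. C * chain_term g (j # a) n ns) summable_on chains (Suc (length a)) n"
    by (intro summable_on_cmult_right assms)
next
  fix ns assume "ns \<in> chains (Suc (length a)) n"
  then obtain N ms where ns: "ns = N # ms" "N > n" by (rule chains_SucE)
  then show "chain_term h (k # a) n ns \<le> C * chain_term g (j # a) n ns"
    using mult_right_mono[OF le[of N] chain_monomial_nonneg[of a ms]]
    by (simp add: chain_term_Cons mult.assoc)
qed (simp add: chain_term_nonneg nonneg)

lemma inverse_power_le: "N \<ge> 1 \<Longrightarrow> j \<le> k \<Longrightarrow> inverse (real N ^ k) \<le> inverse (real N ^ j)"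
  by (intro le_imp_inverse_le power_increasing) auto

text \<open>A leading part 1 is harmless because the weight decays. Summing out that part leaves a
  multiple of the same weight on \<open>a\<close>, whose leading part is at least 1 and is therefore
  dominated by the case of leading part 1, covered by induction.\<close>

lemma summable_on_chains_telescope:
  assumes "composition a" "m \<ge> 1"
  shows "chain_term (inv_binom m) (1 # a) n summable_on chains (Suc (length a)) n"
  using assms(1)
proof (induction a)
  case Nil
  show ?case
    by (rule chain_term_Cons_summable[where h' = "\<lambda>x. inverse (real m) * inv_binom m x"])
       (use has_sum_inv_binom_telescope[OF assms(2)] in \<open>auto simp: inv_binom_nonneg\<close>)
next
  case (Cons k a)
  have "chain_term (\<lambda>x. inverse (real m) * inv_binom m x) (k # a) n summable_on
          chains (Suc (length a)) n"
  proof (rule chain_term_Cons_comparison[where j = 1])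
    show "chain_term (inv_binom m) (1 # a) n summable_on chains (Suc (length a)) n"
      using Cons by simp
    show "inverse (real m) * inv_binom m N * inverse (real N ^ k)
            \<le> inverse (real m) * (inv_binom m N * inverse (real N ^ 1))" if "N \<ge> 1" for N
      unfolding mult.assoc
      by (intro mult_left_mono inverse_power_le that) (use Cons.prems in \<open>auto simp: inv_binom_nonneg\<close>)
  qed (simp add: inv_binom_nonneg)
  then show ?case
    by (intro chain_term_Cons_summable[where h' = "\<lambda>x. inverse (real m) * inv_binom m x"])
       (use has_sum_inv_binom_telescope[OF assms(2)] in \<open>auto simp: inv_binom_nonneg\<close>)
qed

lemma summable_on_chains_admissible:
  assumes "admissible a" and h: "\<And>N. h N \<ge> 0" "\<And>N. h N \<le> 1"
  shows "chain_term h a n summable_on chains (length a) n"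
proof (cases a)
  case (Cons k b)
  then have k: "k \<ge> 2" "composition b" using assms(1) by (auto simp: admissible_def)
  have "chain_term h (k # b) n summable_on chains (Suc (length b)) n"
  proof (rule chain_term_Cons_comparison[where j = 1 and C = 2])
    show "chain_term (inv_binom 1) (1 # b) n summable_on chains (Suc (length b)) n"
      using k by (intro summable_on_chains_telescope) auto
    fix N :: nat assume N: "N \<ge> 1"
    have "h N * inverse (real N ^ k) \<le> 1 * inverse (real N ^ 2)"
      by (intro mult_mono inverse_power_le N k h) auto
    \<comment> \<open>The constant 2 comes from N + 1 \<le> 2N.\<close>
    also have "\<dots> \<le> 2 * (inv_binom 1 N * inverse (real N ^ 1))"
      using N by (simp add: inv_binom_1 divide_simps power2_eq_square)
    finally show "h N * inverse (real N ^ k) \<le> 2 * (inv_binom 1 N * inverse (real N ^ 1))" .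
  qed (rule h)
  then show ?thesis by (simp add: Cons)
qed simp

section \<open>Removal of the smallest index and decay of tails\<close>

lemma chains_Suc_conv:
  "chains (Suc r) n = chains (Suc r) (Suc n) \<union> (\<lambda>ns. ns @ [Suc n]) ` chains r (Suc n)"
proof (intro equalityI subsetI)
  fix ns assume ns: "ns \<in> chains (Suc r) n"
  then obtain ms N where "ns = ms @ [N]" by (cases ns rule: rev_cases) (auto simp: chains_def)
  with ns show "ns \<in> chains (Suc r) (Suc n) \<union> (\<lambda>ns. ns @ [Suc n]) ` chains r (Suc n)"
    by (cases "N = Suc n") (force simp: chains_def sorted_wrt_append)+
qed (force simp: chains_def sorted_wrt_append)

text \<open>The difference collects the chains ending in \<open>Suc n\<close>. Removing that index
  keeps the head of \<open>ns @ [Suc n]\<close>, hence the weight; for empty \<open>a\<close> this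
  head is \<open>Suc n\<close> itself, in agreement with the value of \<open>chain_sum\<close> at
  the empty composition.\<close>

lemma chain_sum_snoc_diff:
  assumes "admissible (a @ [k])" and h: "\<And>N. h N \<ge> 0" "\<And>N. h N \<le> 1"
  shows "chain_sum h (a @ [k]) n - chain_sum h (a @ [k]) (Suc n)
           = inverse (real (Suc n) ^ k) * chain_sum h a (Suc n)"
proof -
  let ?f = "chain_term h (a @ [k]) n" and ?r = "length a"
  let ?last = "\<lambda>ns. ns @ [Suc n]"
  have summable: "?f summable_on chains (Suc ?r) n"
    using summable_on_chains_admissible[OF assms] by simp
  have "chain_sum h (a @ [k]) n = infsum ?f (chains (Suc ?r) n)" by (simp add: chain_sum_def)
  also have "\<dots> = infsum ?f (chains (Suc ?r) (Suc n)) + infsum ?f (?last ` chains ?r (Suc n))"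
    unfolding chains_Suc_conv[of ?r n]
  proof (rule infsum_Un_disjoint)
    show "?f summable_on chains (Suc ?r) (Suc n)" "?f summable_on ?last ` chains ?r (Suc n)"
      using chains_Suc_conv[of ?r n] by (auto intro: summable_on_subset_banach[OF summable])
  qed (auto simp: chains_def)
  also have "infsum ?f (chains (Suc ?r) (Suc n)) = chain_sum h (a @ [k]) (Suc n)"
    unfolding chain_sum_def
    by (auto intro!: infsum_cong simp: chain_term_def elim!: chains_SucE)
  also have "infsum ?f (?last ` chains ?r (Suc n)) = infsum (?f \<circ> ?last) (chains ?r (Suc n))"
    by (rule infsum_reindex) (simp add: inj_on_def)
  also have "\<dots> = (\<Sum>\<^sub>\<infinity>ns\<in>chains ?r (Suc n). inverse (real (Suc n) ^ k) * chain_term h a (Suc n) ns)"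
    by (intro infsum_cong)
       (auto simp: chain_term_def chain_monomial_snoc chains_def hd_append)
  also have "\<dots> = inverse (real (Suc n) ^ k) * chain_sum h a (Suc n)"
    by (simp add: chain_sum_def infsum_cmult_right')
  finally show ?thesis by simp
qed

text \<open>The weight is at most 1/(n+1) on indices above \<open>n\<close>, and chains above
  \<open>n\<close> are among those above 0, so the tail is at most 1/(n+1) times a fixed convergent
  sum. The weight may vary with \<open>n\<close>, as it does for diagonal double tails.\<close>

lemma chain_sum_tendsto_0:
  assumes "admissible a" "a \<noteq> []" and h: "\<And>n N. h n N \<ge> 0" "\<And>n N. h n N \<le> 1"
    and bound: "\<And>n N. N > n \<Longrightarrow> h n N \<le> inverse (real (Suc n))"
  shows "(\<lambda>n. chain_sum (h n) a n) \<longlonglongrightarrow> 0"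
proof (rule tendsto_sandwich[of "\<lambda>_. 0"])
  let ?C = "chain_sum (\<lambda>_. 1) a 0"
  have "chain_sum (h n) a n \<le> inverse (real (Suc n)) * ?C" for n
  proof -
    have "chain_sum (h n) a n \<le> infsum (\<lambda>ns. inverse (real (Suc n)) * chain_term (\<lambda>_. 1) a 0 ns) (chains (length a) 0)"
      unfolding chain_sum_def
    proof (rule infsum_mono_neutral)
      show "chain_term (h n) a n summable_on chains (length a) n"
        by (intro summable_on_chains_admissible assms)
      show "(\<lambda>ns. inverse (real (Suc n)) * chain_term (\<lambda>_. 1) a 0 ns) summable_on chains (length a) 0"
        by (intro summable_on_cmult_right summable_on_chains_admissible assms) auto
      fix ns assume "ns \<in> chains (length a) n \<inter> chains (length a) 0"
      \<comment> \<open>Non-emptiness enters here: the head is a genuine index of the chain, not the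
        default \<open>n\<close>.\<close>
      then have "hd (ns @ [n]) > n"
        using assms(2) by (cases ns) (auto simp: chains_def)
      then show "chain_term (h n) a n ns \<le> inverse (real (Suc n)) * chain_term (\<lambda>_. 1) a 0 ns"
        unfolding chain_term_def mult_1 by (intro mult_right_mono bound chain_monomial_nonneg)
    next
      fix ns assume "ns \<in> chains (length a) n - chains (length a) 0"
      then show "chain_term (h n) a n ns \<le> 0" by (auto simp: chains_def)
    qed (simp add: chain_term_nonneg)
    then show ?thesis by (simp add: chain_sum_def infsum_cmult_right')
  qed
  then show "\<forall>\<^sub>F n in sequentially. chain_sum (h n) a n \<le> inverse (real (Suc n)) * ?C" by simp
  show "\<forall>\<^sub>F n in sequentially. 0 \<le> chain_sum (h n) a n"
    by (simp add: chain_sum_def infsum_nonneg chain_term_nonneg h)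
  show "(\<lambda>n. inverse (real (Suc n)) * ?C) \<longlonglongrightarrow> 0"
    by (intro tendsto_mult_left_zero LIMSEQ_inverse_real_of_nat)
qed auto

section \<open>Recurrences for zeta and sigma tails\<close>

lemma sum_list_dropWhile_le: "sum_list (dropWhile P a) \<le> sum_list a" for a :: "nat list"
  by (induction a) auto

text \<open>Each leading 1 is summed out by telescoping at the cost of a factor 1/(m+1); the drop in
  weight counts these ones.\<close>

lemma chain_sum_inv_binom_drop_ones:
  assumes "composition a"
  shows "chain_sum (inv_binom (Suc m)) a n
           = inverse (real (Suc m) ^ (sum_list a - sum_list (dropWhile (\<lambda>j. j = 1) a)))
             * chain_sum (inv_binom (Suc m)) (dropWhile (\<lambda>j. j = 1) a) n"
  using assms
proof (induction a)
  case (Cons k a)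
  show ?case
  proof (cases "k = 1")
    case True
    let ?h = "\<lambda>x. inverse (real (Suc m)) * inv_binom (Suc m) x"
    have "chain_sum (inv_binom (Suc m)) (1 # a) n = chain_sum ?h a n"
      using has_sum_inv_binom_telescope[of "Suc m"] Cons.prems
      by (intro chain_sum_Cons summable_on_chains_telescope) auto
    also have "\<dots> = inverse (real (Suc m)) * chain_sum (inv_binom (Suc m)) a n"
      by (simp add: chain_sum_def chain_term_def mult.assoc infsum_cmult_right')
    finally show ?thesis
      using Cons True sum_list_dropWhile_le[of _ a] by (simp add: Suc_diff_le)
  qed simp
qed simp

lemma zeta_tail_eq_chain_sum: "zeta_tail a m n = chain_sum (inv_binom m) a n"
proof (cases "a = []")
  case False
  then show ?thesis
    by (auto simp: zeta_tail_def chain_sum_def chain_term_def chain_monomial_def inv_binom_def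
        chains_def hd_append intro!: infsum_cong)
qed (simp add: zeta_tail_def inv_binom_def add.commute)

lemma sigma_tail_eq_chain_sum: "sigma_tail a n = chain_sum (\<lambda>N. inv_binom N N) a n"
proof (cases "a = []")
  case False
  then show ?thesis
    by (auto simp: sigma_tail_def chain_sum_def chain_term_def chain_monomial_def inv_binom_def
        chains_def hd_append mult_2 intro!: infsum_cong)
qed (simp add: sigma_tail_def inv_binom_def mult_2)

lemma infsum_diff_real:
  fixes f g :: "'a \<Rightarrow> real"
  assumes "f summable_on A" "g summable_on A"
  shows "infsum (\<lambda>x. f x - g x) A = infsum f A - infsum g A"
  using infsum_add[OF assms(1), of "\<lambda>x. - g x"] assms(2)
  by (simp add: infsum_uminus summable_on_uminus)

text \<open>The difference of weights turns the leading part \<open>k\<close> into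
  \<open>k - 1\<close> and yields one factor 1/(m+1). If k = 2 the new leading 1, together with any
  ones following it, is then summed out.\<close>

lemma zeta_tail_diff_left:
  assumes "admissible a" "a \<noteq> []"
  shows "zeta_tail a m n - zeta_tail a (Suc m) n
    = inverse (real (Suc m) ^ (sum_list a - sum_list (fin_list a))) * zeta_tail (fin_list a) (Suc m) n"
proof -
  obtain k b where a: "a = k # b" "k \<ge> 2" "composition b"
    using assms by (cases a) (auto simp: admissible_def)
  let ?c = "(k - 1) # b"
  \<comment> \<open>Both branches of \<open>fin_list\<close> at once: \<open>k - 1\<close> is
    dropped exactly when k = 2.\<close>
  have fin: "dropWhile (\<lambda>j. j = 1) ?c = fin_list a" using a by auto
  have le: "sum_list (fin_list a) \<le> sum_list ?c"
    unfolding fin[symmetric] by (rule sum_list_dropWhile_le)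
  have "zeta_tail a m n - zeta_tail a (Suc m) n
      = (\<Sum>\<^sub>\<infinity>ns\<in>chains (length a) n. chain_term (inv_binom m) a n ns - chain_term (inv_binom (Suc m)) a n ns)"
    unfolding zeta_tail_eq_chain_sum chain_sum_def
    by (intro infsum_diff_real[symmetric] summable_on_chains_admissible assms inv_binom_nonneg inv_binom_le_1)
  also have "\<dots> = (\<Sum>\<^sub>\<infinity>ns\<in>chains (Suc (length b)) n. inverse (real (Suc m)) * chain_term (inv_binom (Suc m)) ?c n ns)"
  proof (rule infsum_cong_neutral)
    fix ns assume "ns \<in> chains (length a) n \<inter> chains (Suc (length b)) n"
    then obtain N ms where N: "ns = N # ms" "N > n" by (auto elim: chains_SucE)
    have "real N * inverse (real N ^ k) = inverse (real N ^ (k - 1))"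
      using a(2) N(2) by (cases k) auto
    then show "chain_term (inv_binom m) a n ns - chain_term (inv_binom (Suc m)) a n ns
        = inverse (real (Suc m)) * chain_term (inv_binom (Suc m)) ?c n ns"
      unfolding a N chain_term_Cons left_diff_distrib[symmetric] inv_binom_diff_left
      by (simp add: mult_ac)
  qed (auto simp: a)
  also have "\<dots> = inverse (real (Suc m)) * chain_sum (inv_binom (Suc m)) ?c n"
    by (simp add: chain_sum_def infsum_cmult_right')
  also have "chain_sum (inv_binom (Suc m)) ?c n
      = inverse (real (Suc m) ^ (sum_list ?c - sum_list (fin_list a))) * chain_sum (inv_binom (Suc m)) (fin_list a) n"
    unfolding fin[symmetric] using a by (intro chain_sum_inv_binom_drop_ones) simp
  also have "sum_list a - sum_list (fin_list a) = Suc (sum_list ?c - sum_list (fin_list a))"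
    using a le by (simp add: a(1) del: fin_list.simps)
  then show ?thesis using calculation
    by (simp add: zeta_tail_eq_chain_sum)
qed

lemma zeta_tail_adm_diff_left:
  assumes "a \<noteq> adm_empty"
  shows "zeta_tail (parts a) m n - zeta_tail (parts a) (Suc m) n
    = inverse (real (Suc m) ^ (weight a - weight (adm_fin a))) * zeta_tail (parts (adm_fin a)) (Suc m) n"
  unfolding weight.rep_eq parts_adm_fin
  by (rule zeta_tail_diff_left) (use parts[of a] assms in \<open>auto simp: parts_eq_Nil\<close>)

lemma zeta_tail_adm_diff_right:
  assumes "a \<noteq> adm_empty"
  shows "zeta_tail (parts a) m n - zeta_tail (parts a) m (Suc n)
    = inverse (real (Suc n) ^ (weight a - weight (adm_init a))) * zeta_tail (parts (adm_init a)) m (Suc n)"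
proof -
  obtain b k where a: "parts a = b @ [k]"
    using assms parts_eq_Nil by (metis rev_exhaust)
  then have "parts (adm_init a) = b" "weight a - weight (adm_init a) = k"
    by (simp_all add: adm_init.rep_eq weight.rep_eq)
  then show ?thesis
    using parts[of a] unfolding a zeta_tail_eq_chain_sum
    by (simp only: mem_Collect_eq chain_sum_snoc_diff inv_binom_nonneg inv_binom_le_1)
qed

lemma sigma_tail_adm_diff:
  assumes "k \<ge> 2" "weight b < k"
  shows "sigma_tail (parts (adm_snoc k b)) n - sigma_tail (parts (adm_snoc k b)) (Suc n)
    = inverse (real (Suc n) ^ (k - weight b)) * sigma_tail (parts b) (Suc n)"
  unfolding parts_adm_snoc[OF assms] sigma_tail_eq_chain_sum
proof (rule chain_sum_snoc_diff)
  show "admissible (parts b @ [k - weight b])"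
    using parts[of "adm_snoc k b"] parts_adm_snoc[OF assms] by simp
qed (simp_all add: inv_binom_nonneg inv_binom_le_1)

lemma adm_fin_empty: "adm_fin adm_empty = adm_empty"
  by (subst parts_inject[symmetric]) (simp add: parts_adm_fin adm_empty.rep_eq)

text \<open>Passes from (n,n) to (n,n+1), which produces init at (n,n+1), and then to (n+1,n+1),
  which produces fin. Raising the first index of the init term once more yields its fin, which is
  mid because init and fin commute.\<close>

lemma zeta_tail_diagonal_diff:
  assumes "a \<noteq> adm_empty"
  shows "zeta_tail (parts a) n n - zeta_tail (parts a) (Suc n) (Suc n)
    = (\<Sum>x\<leftarrow>[adm_init a, adm_mid a, adm_fin a].
         inverse (real (Suc n) ^ (weight a - weight x)) * zeta_tail (parts x) (Suc n) (Suc n))"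
proof -
  let ?b = "adm_init a" and ?c = "adm_mid a" and ?q = "real (Suc n)"
  have c: "?c = adm_fin ?b" by (simp add: adm_mid_def init_fin)
  have le: "weight ?b \<le> weight a" by (rule weight_init_le)
  have init: "zeta_tail (parts ?b) n (Suc n) = zeta_tail (parts ?b) (Suc n) (Suc n)
      + inverse (?q ^ (weight ?b - weight ?c)) * zeta_tail (parts ?c) (Suc n) (Suc n)"
  \<comment> \<open>In depth one the init is empty and \<open>zeta_tail_adm_diff_left\<close> does
    not apply. The identity survives since N = m + 1 cancels the factor 1/(m+1) in
    \<open>inv_binom_diff_left\<close>, leaving the tail of the empty mid.\<close>
  proof (cases "?b = adm_empty")
    case True
    then have "?c = adm_empty"
      by (simp add: c adm_fin_empty)
    moreover have "inv_binom n (Suc n) - inv_binom (Suc n) (Suc n) = inv_binom (Suc n) (Suc n)"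
      unfolding inv_binom_diff_left by (simp add: mult.assoc[symmetric] del: of_nat_Suc)
    ultimately show ?thesis
      using True
      by (simp add: zeta_tail_eq_chain_sum adm_empty.rep_eq)
  next
    case False
    then show ?thesis
      using zeta_tail_adm_diff_left[of ?b n "Suc n"] by (simp add: c)
  qed
  have "weight ?c \<le> weight ?b"
    unfolding c using weight_fin_less[of ?b] by (cases "?b = adm_empty") (auto simp: adm_fin_empty)
  with le have "weight a - weight ?c = (weight a - weight ?b) + (weight ?b - weight ?c)" by simp
  then have "inverse (?q ^ (weight a - weight ?c))
      = inverse (?q ^ (weight a - weight ?b)) * inverse (?q ^ (weight ?b - weight ?c))"
    by (simp add: power_add)
  then show ?thesis
    using zeta_tail_adm_diff_right[OF assms, of n n] zeta_tail_adm_diff_left[OF assms, of n "Suc n"] init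
    by (simp add: algebra_simps)
qed

section \<open>Linear extension and the recurrence for the tails of \<delta>\<close>

lemma int_lin_ext_superset:
  assumes "finite S" "Poly_Mapping.keys x \<subseteq> S"
  shows "int_lin_ext f x = (\<Sum>a\<in>S. of_int (Poly_Mapping.lookup x a) * f a)"
  unfolding int_lin_ext_def
  by (rule sum.mono_neutral_left) (use assms in \<open>auto simp: in_keys_iff\<close>)

lemma int_lin_ext_0 [simp]: "int_lin_ext f 0 = 0"
  by (simp add: int_lin_ext_def)

lemma int_lin_ext_of [simp]: "int_lin_ext f (frag_of a) = f a"
  by (simp add: int_lin_ext_def)

lemma int_lin_ext_add: "int_lin_ext f (x + y) = int_lin_ext f x + int_lin_ext f y"
proof -
  let ?S = "Poly_Mapping.keys x \<union> Poly_Mapping.keys y"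
  have "finite ?S" "Poly_Mapping.keys (x + y) \<subseteq> ?S"
    by (simp_all add: Poly_Mapping.keys_add)
  then show ?thesis
    by (simp add: int_lin_ext_superset[of ?S] lookup_add algebra_simps sum.distrib)
qed

lemma int_lin_ext_diff: "int_lin_ext f (x - y) = int_lin_ext f x - int_lin_ext f y"
  using int_lin_ext_add[of f "x - y" y] by simp

lemma int_lin_ext_frag_extend:
  "int_lin_ext f (frag_extend g x) = int_lin_ext (\<lambda>a. int_lin_ext f (g a)) x"
  using subset_UNIV
  by (induction x rule: frag_induction) (simp_all add: frag_extend_diff int_lin_ext_diff)

lemma int_lin_ext_cong:
  "(\<And>a. a \<in> Poly_Mapping.keys x \<Longrightarrow> f a = g a) \<Longrightarrow> int_lin_ext f x = int_lin_ext g x"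
  by (simp add: int_lin_ext_def)

lemma int_lin_ext_fun_diff:
  "int_lin_ext (\<lambda>a. f a - g a) x = int_lin_ext f x - int_lin_ext g x"
  by (simp add: int_lin_ext_def algebra_simps sum_subtractf)

lemma int_lin_ext_fun_cmult:
  "int_lin_ext (\<lambda>a. c * f a) x = c * int_lin_ext f x"
  by (simp add: int_lin_ext_def sum_distrib_left mult_ac)

text \<open>\<open>delta_rec a\<close> is built by appending a last part, and the difference of
  tails strips it again. All compositions in the support of \<open>delta_rec x\<close> have the
  weight of \<open>x\<close>, so the power of n+1 is constant on each of the three summands.\<close>

lemma sigma_tail_lin_delta_rec_diff:
  assumes "a \<noteq> adm_empty"
  shows "sigma_tail_lin (delta_rec a) n - sigma_tail_lin (delta_rec a) (Suc n)
    = (\<Sum>x\<leftarrow>[adm_init a, adm_mid a, adm_fin a].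
         inverse (real (Suc n) ^ (weight a - weight x)) * sigma_tail_lin (delta_rec x) (Suc n))"
proof -
  let ?k = "weight a"
  let ?x = "delta_rec (adm_init a) + delta_rec (adm_mid a) + delta_rec (adm_fin a)"
  let ?f = "\<lambda>b. inverse (real (Suc n) ^ (?k - weight b)) * sigma_tail (parts b) (Suc n)"
  have less: "weight b < ?k" if "b \<in> Poly_Mapping.keys ?x" for b
    using assms keys_delta_rec that by (rule weight_less_if_keys)
  have "sigma_tail_lin (delta_rec a) n - sigma_tail_lin (delta_rec a) (Suc n)
      = int_lin_ext (\<lambda>b. sigma_tail (parts (adm_snoc ?k b)) n - sigma_tail (parts (adm_snoc ?k b)) (Suc n)) ?x"
    using assms
    by (simp add: delta_rec.simps[of a] sigma_tail_lin_def int_lin_ext_frag_extend int_lin_ext_fun_diff)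
  also have "\<dots> = int_lin_ext ?f ?x"
    by (intro int_lin_ext_cong sigma_tail_adm_diff weight_ge_2 assms less)
  finally have *: "sigma_tail_lin (delta_rec a) n - sigma_tail_lin (delta_rec a) (Suc n) = int_lin_ext ?f ?x" .
  have "int_lin_ext ?f (delta_rec y)
      = inverse (real (Suc n) ^ (?k - weight y)) * sigma_tail_lin (delta_rec y) (Suc n)" for y
    unfolding sigma_tail_lin_def int_lin_ext_fun_cmult[symmetric]
    using keys_delta_rec[of y] by (intro int_lin_ext_cong) (auto simp: adm_of_weight_def)
  then show ?thesis by (simp add: * int_lin_ext_add)
qed

section \<open>Limits and comparison of the two sides\<close>

lemma zeta_tail_diagonal_tendsto_0:
  assumes "a \<noteq> adm_empty"
  shows "(\<lambda>n. zeta_tail (parts a) n n) \<longlonglongrightarrow> 0"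
  unfolding zeta_tail_eq_chain_sum
proof (rule chain_sum_tendsto_0)
  fix n N :: nat assume "n < N"
  then have "inv_binom n N \<le> inverse (real n + 1)"
    using inv_binom_le_inverse[of N n] inv_binom_commute[of n N] by simp
  then show "inv_binom n N \<le> inverse (real (Suc n))" by (simp add: add.commute)
qed (use parts[of a] assms in \<open>auto simp: parts_eq_Nil inv_binom_nonneg inv_binom_le_1\<close>)

lemma sigma_tail_tendsto_0:
  assumes "a \<noteq> adm_empty"
  shows "sigma_tail (parts a) \<longlonglongrightarrow> 0"
  unfolding sigma_tail_eq_chain_sum
proof (rule chain_sum_tendsto_0)
  fix n N :: nat assume "n < N"
  then have "inv_binom N N \<le> inverse (real N + 1)" by (intro inv_binom_le_inverse) simp
  also have "\<dots> \<le> inverse (real (Suc n))" using \<open>n < N\<close> by (intro le_imp_inverse_le) auto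
  finally show "inv_binom N N \<le> inverse (real (Suc n))" .
qed (use parts[of a] assms in \<open>auto simp: parts_eq_Nil inv_binom_nonneg inv_binom_le_1\<close>)

lemma sigma_tail_lin_delta_rec_tendsto_0:
  assumes "a \<noteq> adm_empty"
  shows "sigma_tail_lin (delta_rec a) \<longlonglongrightarrow> 0"
  unfolding sigma_tail_lin_def int_lin_ext_def
proof (intro tendsto_null_sum tendsto_mult_right_zero sigma_tail_tendsto_0)
  fix b assume "b \<in> Poly_Mapping.keys (delta_rec a)"
  then have "weight b = weight a" using keys_delta_rec by (auto simp: adm_of_weight_def)
  then show "b \<noteq> adm_empty" using assms by (auto simp: weight_eq_0)
qed

theorem zeta_tail_diagonal_eq_sigma_tail_lin:
  "zeta_tail (parts a) n n = sigma_tail_lin (delta_rec a) n"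
proof (induction a arbitrary: n rule: measure_induct_rule[of weight])
  case (less a)
  show ?case
  proof (cases "a = adm_empty")
    case True
    \<comment> \<open>Both sides are \<open>inv_binom n n\<close>.\<close>
    then show ?thesis
      by (simp add: delta_rec.simps[of adm_empty] sigma_tail_lin_def zeta_tail_eq_chain_sum
          sigma_tail_eq_chain_sum adm_empty.rep_eq)
  next
    case False
    let ?D = "\<lambda>n. zeta_tail (parts a) n n - sigma_tail_lin (delta_rec a) n"
    \<comment> \<open>The right-hand sides of the two recurrences involve smaller weights at n+1,
      where the induction hypothesis identifies them.\<close>
    have step: "?D (Suc n) = ?D n" for n
      using zeta_tail_diagonal_diff[OF False, of n] sigma_tail_lin_delta_rec_diff[OF False, of n]
        less[OF weight_init_less[OF False]] less[OF weight_mid_less[OF False]]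
        less[OF weight_fin_less[OF False]]
      by simp
    have const: "?D m = ?D 0" for m
    proof (induction m)
      case (Suc m)
      then show ?case using step[of m] by (rule trans[rotated])
    qed simp
    have "?D \<longlonglongrightarrow> 0"
      using tendsto_diff[OF zeta_tail_diagonal_tendsto_0[OF False] sigma_tail_lin_delta_rec_tendsto_0[OF False]]
      by simp
    then have "(\<lambda>_. ?D 0) \<longlonglongrightarrow> 0" by (subst (asm) const)
    then have "?D 0 = 0" by (simp only: LIMSEQ_const_iff)
    then have "?D n = 0" by (rule trans[OF const])
    then show ?thesis by simp
  qed
qed

text \<open>Shows that the description defining \<open>zeta_class\<close> denotes: the diagonal tail
  equals an expression in \<open>delta_rec\<close>, which takes the same value at every
  representative of the class.\<close>

lemma zeta_class_eq: "zeta_class b n = sigma_tail_lin (delta_rec (rep_class b)) n"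
proof -
  have "zeta_tail (parts a) n n = sigma_tail_lin (delta_rec (rep_class b)) n" if "cls a = b" for a
    using that delta_rec_rep_cls[of a] by (simp add: zeta_tail_diagonal_eq_sigma_tail_lin)
  moreover have "cls (rep_class b) = b" by (metis Quotient3_adm_class Quotient3_abs_rep)
  ultimately show ?thesis
    unfolding zeta_class_def by (intro the_equality) auto
qed

theorem theorem11:
  fixes l :: "adm_class \<Rightarrow>\<^sub>0 int"
  shows "(\<forall>n. zeta_diag_lin l n = sigma_tail_lin (delta l) n) \<and>
         zeta_lin l = sigma_lin (delta l)"
proof -
  \<comment> \<open>Uniqueness replaces the abstractly characterised map by the recursive one, for
    which the basis case is known.\<close>
  have delta: "delta = frag_extend (\<lambda>b. delta_rec (rep_class b))"
    using is_delta_unique[OF is_delta_delta is_delta_delta_rec] .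
  have "zeta_diag_lin l n = sigma_tail_lin (delta l) n" for n
    unfolding delta
    by (simp add: zeta_diag_lin_def zeta_class_eq sigma_tail_lin_def int_lin_ext_frag_extend)
  then show ?thesis by (simp add: zeta_lin_def sigma_lin_def)
qed

end
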